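(* Let $\mathbf K$ be a small monoidal triangulated category. Then the following hold. (a) A proper thick ideal $\mathbf P$ of $\mathbf K$ is prime if and only if for all $A,B\in\mathbf K$: if $A\otimes C\otimes B\in\mathbf P$ for all $C\in\mathbf K$, then $A\in\mathbf P$ or $B\in\mathbf P$. (b) A proper thick ideal $\mathbf P$ of $\mathbf K$ is semiprime if and only if for all $A\in\mathbf K$: if $A\otimes C\otimes A\in\mathbf P$ for all $C\in\mathbf K$, then $A\in\mathbf P$. (c) The Balmer spectrum $\mathrm{Spc}\,\mathbf K$ is always nonempty.
   Context: A monoidal triangulated category (M$\Delta$C) is a monoidal category $\mathbf K$ (with unit object $1$) which is also triangulated and for which $\otimes:\mathbf K\times\mathbf K\to\mathbf K$ is an exact bifunctor; no symmetry or braiding is assumed. A thick (two-sided) ideal of $\mathbf K$ is a full triangulated subcategory of $\mathbf K$ that contains all direct summands of its objects and is closed under left and right tensoring with arbitrary objects of $\mathbf K$. For thick ideals $\mathbf I,\mathbf J$, write $\mathbf I\otimes\mathbf J$ for the collection of (objects isomorphic to) $A\otimes B$ with $A\in\mathbf I$, $B\in\mathbf J$. A prime ideal of $\mathbf K$ is a proper thick ideal $\mathbf P$ such that for all thick ideals $\mathbf I,\mathbf J$ of $\mathbf K$, $\mathbf I\otimes\mathbf J\subseteq\mathbf P$ implies $\mathbf I\subseteq\mathbf P$ or $\mathbf J\subseteq\mathbf P$. A semiprime ideal is an intersection of prime ideals. The (noncommutative) Balmer spectrum $\mathrm{Spc}\,\mathbf K$ is the set of prime ideals of $\mathbf K$,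 with the Zariski topology whose closed sets are $V(\mathcal S)=\{\mathbf P\in\mathrm{Spc}\,\mathbf K:\mathbf P\cap\mathcal S=\varnothing\}$ for subsets $\mathcal S$ of $\mathbf K$.
   Formalization: Part (c) is proved under the added assumption that K has a nonzero object: if K = 0, the only thick ideal is K itself, so there is no proper thick ideal and Spc K is empty. *)

theory Defs
  imports "HOL-Algebra.Group"
begin

section \<open>Categories\<close>

record ('o, 'm) cat =
  Ob :: "'o set"
  Arr :: "'m set"
  Dom :: "'m \<Rightarrow> 'o"
  Cod :: "'m \<Rightarrow> 'o"
  Id :: "'o \<Rightarrow> 'm"
  Comp :: "'m \<Rightarrow> 'm \<Rightarrow> 'm"  (infixr "\<cdot>\<index>" 75)

definition Hom :: "('o, 'm, 'z) cat_scheme \<Rightarrow> 'o \<Rightarrow> 'o \<Rightarrow> 'm set" where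
  "Hom C A B = {f \<in> Arr C. Dom C f = A \<and> Cod C f = B}"

locale category =
  fixes C :: "('o, 'm, 'z) cat_scheme" (structure)
  assumes Dom_Ob: "f \<in> Arr C \<Longrightarrow> Dom C f \<in> Ob C"
    and Cod_Ob: "f \<in> Arr C \<Longrightarrow> Cod C f \<in> Ob C"
    and Id_Hom: "A \<in> Ob C \<Longrightarrow> Id C A \<in> Hom C A A"
    and Comp_Hom: "f \<in> Hom C A B \<Longrightarrow> g \<in> Hom C B D \<Longrightarrow> g \<cdot> f \<in> Hom C A D"
    and Comp_Id: "f \<in> Hom C A B \<Longrightarrow> f \<cdot> Id C A = f"
    and Id_Comp: "f \<in> Hom C A B \<Longrightarrow> Id C B \<cdot> f = f"
    and Comp_assoc: "f \<in> Hom C A B \<Longrightarrow> g \<in> Hom C B D \<Longrightarrow> h \<in> Hom C D E \<Longrightarrow>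
      (h \<cdot> g) \<cdot> f = h \<cdot> (g \<cdot> f)"

definition is_iso :: "('o, 'm, 'z) cat_scheme \<Rightarrow> 'm \<Rightarrow> bool" where
  "is_iso C f \<longleftrightarrow> f \<in> Arr C \<and>
    (\<exists>g \<in> Hom C (Cod C f) (Dom C f).
      g \<cdot>\<^bsub>C\<^esub> f = Id C (Dom C f) \<and> f \<cdot>\<^bsub>C\<^esub> g = Id C (Cod C f))"

definition isomorphic :: "('o, 'm, 'z) cat_scheme \<Rightarrow> 'o \<Rightarrow> 'o \<Rightarrow> bool" where
  "isomorphic C A B \<longleftrightarrow> (\<exists>f \<in> Hom C A B. is_iso C f)"

definition zero_object :: "('o, 'm, 'z) cat_scheme \<Rightarrow> 'o \<Rightarrow> bool" where
  "zero_object C Z \<longleftrightarrow> Z \<in> Ob C \<and>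
    (\<forall>A \<in> Ob C. (\<exists>!f. f \<in> Hom C A Z) \<and> (\<exists>!f. f \<in> Hom C Z A))"

definition product_cat ::
  "('o, 'm, 'y) cat_scheme \<Rightarrow> ('p, 'n, 'z) cat_scheme \<Rightarrow> ('o \<times> 'p, 'm \<times> 'n) cat" where
  "product_cat C D =
    \<lparr>Ob = Ob C \<times> Ob D,
     Arr = Arr C \<times> Arr D,
     Dom = (\<lambda>(f, g). (Dom C f, Dom D g)),
     Cod = (\<lambda>(f, g). (Cod C f, Cod D g)),
     Id = (\<lambda>(A, B). (Id C A, Id D B)),
     Comp = (\<lambda>(f', g') (f, g). (f' \<cdot>\<^bsub>C\<^esub> f, g' \<cdot>\<^bsub>D\<^esub> g))\<rparr>"

text \<open>A functor is given by its object part \<open>Fo\<close> and its arrow part \<open>Fa\<close>.\<close>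

locale cat_functor = C: category C + D: category D
  for C :: "('o, 'm, 'y) cat_scheme" and D :: "('p, 'n, 'z) cat_scheme" +
  fixes Fo :: "'o \<Rightarrow> 'p" and Fa :: "'m \<Rightarrow> 'n"
  assumes Fo_Ob: "A \<in> Ob C \<Longrightarrow> Fo A \<in> Ob D"
    and Fa_Hom: "f \<in> Hom C A B \<Longrightarrow> Fa f \<in> Hom D (Fo A) (Fo B)"
    and Fa_Id: "A \<in> Ob C \<Longrightarrow> Fa (Id C A) = Id D (Fo A)"
    and Fa_Comp: "f \<in> Hom C A B \<Longrightarrow> g \<in> Hom C B E \<Longrightarrow>
      Fa (g \<cdot>\<^bsub>C\<^esub> f) = Fa g \<cdot>\<^bsub>D\<^esub> Fa f"

locale natural_iso = F: cat_functor C D Fo Fa + G: cat_functor C D Go Ga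
  for C :: "('o, 'm, 'y) cat_scheme" and D :: "('p, 'n, 'z) cat_scheme"
    and Fo Fa Go Ga +
  fixes \<eta> :: "'o \<Rightarrow> 'n"
  assumes component_Hom: "A \<in> Ob C \<Longrightarrow> \<eta> A \<in> Hom D (Fo A) (Go A)"
    and component_iso: "A \<in> Ob C \<Longrightarrow> is_iso D (\<eta> A)"
    and naturality: "f \<in> Hom C A B \<Longrightarrow> \<eta> B \<cdot>\<^bsub>D\<^esub> Fa f = Ga f \<cdot>\<^bsub>D\<^esub> \<eta> A"

definition equivalence_of_cats ::
  "('o, 'm, 'y) cat_scheme \<Rightarrow> ('p, 'n, 'z) cat_scheme \<Rightarrow> ('o \<Rightarrow> 'p) \<Rightarrow> ('m \<Rightarrow> 'n) \<Rightarrow> bool" where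
  "equivalence_of_cats C D Fo Fa \<longleftrightarrow> cat_functor C D Fo Fa \<and>
    (\<exists>Go Ga. cat_functor D C Go Ga \<and>
      (\<exists>\<eta>. natural_iso C C (\<lambda>A. A) (\<lambda>f. f) (Go \<circ> Fo) (Ga \<circ> Fa) \<eta>) \<and>
      (\<exists>\<epsilon>. natural_iso D D (Fo \<circ> Go) (Fa \<circ> Ga) (\<lambda>A. A) (\<lambda>f. f) \<epsilon>))"


section \<open>Additive categories\<close>

record ('o, 'm) additive_cat = "('o, 'm) cat" +
  Add :: "'m \<Rightarrow> 'm \<Rightarrow> 'm"
  Zero :: "'o \<Rightarrow> 'o \<Rightarrow> 'm"

definition hom_group :: "('o, 'm, 'z) additive_cat_scheme \<Rightarrow> 'o \<Rightarrow> 'o \<Rightarrow> 'm monoid" where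
  "hom_group C A B = \<lparr>carrier = Hom C A B, mult = Add C, one = Zero C A B\<rparr>"

definition Neg :: "('o, 'm, 'z) additive_cat_scheme \<Rightarrow> 'm \<Rightarrow> 'm" where
  "Neg C f = inv\<^bsub>hom_group C (Dom C f) (Cod C f)\<^esub> f"

definition is_direct_sum ::
  "('o, 'm, 'z) additive_cat_scheme \<Rightarrow> 'o \<Rightarrow> 'o \<Rightarrow> 'o \<Rightarrow> bool" where
  "is_direct_sum C S A B \<longleftrightarrow> S \<in> Ob C \<and> A \<in> Ob C \<and> B \<in> Ob C \<and>
    (\<exists>i \<in> Hom C A S. \<exists>j \<in> Hom C B S. \<exists>p \<in> Hom C S A. \<exists>q \<in> Hom C S B.
      p \<cdot>\<^bsub>C\<^esub> i = Id C A \<and> q \<cdot>\<^bsub>C\<^esub> j = Id C B \<and>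
      q \<cdot>\<^bsub>C\<^esub> i = Zero C A B \<and> p \<cdot>\<^bsub>C\<^esub> j = Zero C B A \<and>
      Add C (i \<cdot>\<^bsub>C\<^esub> p) (j \<cdot>\<^bsub>C\<^esub> q) = Id C S)"

locale additive_category = category C
  for C :: "('o, 'm, 'z) additive_cat_scheme" (structure) +
  assumes hom_comm_group: "A \<in> Ob C \<Longrightarrow> B \<in> Ob C \<Longrightarrow> comm_group (hom_group C A B)"
    and Comp_Add: "f \<in> Hom C A B \<Longrightarrow> g \<in> Hom C B D \<Longrightarrow> g' \<in> Hom C B D \<Longrightarrow>
      Add C g g' \<cdot> f = Add C (g \<cdot> f) (g' \<cdot> f)"
    and Add_Comp: "f \<in> Hom C A B \<Longrightarrow> f' \<in> Hom C A B \<Longrightarrow> g \<in> Hom C B D \<Longrightarrow>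
      g \<cdot> Add C f f' = Add C (g \<cdot> f) (g \<cdot> f')"
    and ex_zero_object: "\<exists>Z. zero_object C Z"
    and ex_direct_sum: "A \<in> Ob C \<Longrightarrow> B \<in> Ob C \<Longrightarrow> \<exists>S. is_direct_sum C S A B"

locale additive_functor =
  C: additive_category C + D: additive_category D + cat_functor C D Fo Fa
  for C :: "('o, 'm, 'y) additive_cat_scheme" and D :: "('p, 'n, 'z) additive_cat_scheme"
    and Fo Fa +
  assumes Fa_Add: "f \<in> Hom C A B \<Longrightarrow> g \<in> Hom C A B \<Longrightarrow>
    Fa (Add C f g) = Add D (Fa f) (Fa g)"


section \<open>Triangulated categories\<close>

text \<open>The shift is an additive autoequivalence, not necessarily a strict automorphism.
  \<open>(f, g, h) \<in> Dist K\<close> says that \<open>X \<rightarrow> Y \<rightarrow> Z \<rightarrow> \<Sigma>X\<close> with arrows \<open>f\<close>, \<open>g\<close>, \<open>h\<close> is a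
  distinguished triangle; the objects are recovered from the arrows.\<close>

record ('o, 'm) triangulated_cat = "('o, 'm) additive_cat" +
  ShO :: "'o \<Rightarrow> 'o"
  ShA :: "'m \<Rightarrow> 'm"
  Dist :: "('m \<times> 'm \<times> 'm) set"

definition is_triangle ::
  "('o, 'm, 'z) triangulated_cat_scheme \<Rightarrow> 'o \<Rightarrow> 'o \<Rightarrow> 'o \<Rightarrow> 'm \<Rightarrow> 'm \<Rightarrow> 'm \<Rightarrow> bool" where
  "is_triangle K X Y Z f g h \<longleftrightarrow>
    f \<in> Hom K X Y \<and> g \<in> Hom K Y Z \<and> h \<in> Hom K Z (ShO K X)"

definition dist_triangle ::
  "('o, 'm, 'z) triangulated_cat_scheme \<Rightarrow> 'o \<Rightarrow> 'o \<Rightarrow> 'o \<Rightarrow> 'm \<Rightarrow> 'm \<Rightarrow> 'm \<Rightarrow> bool" where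
  "dist_triangle K X Y Z f g h \<longleftrightarrow> is_triangle K X Y Z f g h \<and> (f, g, h) \<in> Dist K"

locale triangulated_category = additive_category K
  for K :: "('o, 'm, 'z) triangulated_cat_scheme" (structure) +
  assumes shift_additive: "additive_functor K K (ShO K) (ShA K)"
    and shift_equivalence: "equivalence_of_cats K K (ShO K) (ShA K)"
    and Dist_triangle: "(f, g, h) \<in> Dist K \<Longrightarrow> \<exists>X Y Z. is_triangle K X Y Z f g h"
    and TR1_iso: "dist_triangle K X Y Z f g h \<Longrightarrow> is_triangle K X' Y' Z' f' g' h' \<Longrightarrow>
      a \<in> Hom K X X' \<Longrightarrow> b \<in> Hom K Y Y' \<Longrightarrow> c \<in> Hom K Z Z' \<Longrightarrow>
      is_iso K a \<Longrightarrow> is_iso K b \<Longrightarrow> is_iso K c \<Longrightarrow>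
      b \<cdot> f = f' \<cdot> a \<Longrightarrow> c \<cdot> g = g' \<cdot> b \<Longrightarrow> ShA K a \<cdot> h = h' \<cdot> c \<Longrightarrow>
      dist_triangle K X' Y' Z' f' g' h'"
    and TR1_Id: "X \<in> Ob K \<Longrightarrow> zero_object K Z \<Longrightarrow>
      dist_triangle K X X Z (Id K X) (Zero K X Z) (Zero K Z (ShO K X))"
    and TR1_cone: "f \<in> Hom K X Y \<Longrightarrow> \<exists>Z g h. dist_triangle K X Y Z f g h"
    and TR2: "is_triangle K X Y Z f g h \<Longrightarrow>
      dist_triangle K X Y Z f g h \<longleftrightarrow> dist_triangle K Y Z (ShO K X) g h (Neg K (ShA K f))"
    and TR3: "dist_triangle K X Y Z f g h \<Longrightarrow> dist_triangle K X' Y' Z' f' g' h' \<Longrightarrow>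
      a \<in> Hom K X X' \<Longrightarrow> b \<in> Hom K Y Y' \<Longrightarrow> b \<cdot> f = f' \<cdot> a \<Longrightarrow>
      \<exists>c \<in> Hom K Z Z'. c \<cdot> g = g' \<cdot> b \<and> ShA K a \<cdot> h = h' \<cdot> c"
    and TR4: "dist_triangle K X Y Z' f f' f'' \<Longrightarrow> dist_triangle K Y Z X' g g' g'' \<Longrightarrow>
      dist_triangle K X Z Y' (g \<cdot> f) h' h'' \<Longrightarrow>
      \<exists>u v. dist_triangle K Z' Y' X' u v (ShA K f' \<cdot> g'') \<and>
        u \<cdot> f' = h' \<cdot> g \<and> h'' \<cdot> u = f'' \<and> v \<cdot> h' = g' \<and> g'' \<cdot> v = ShA K f \<cdot> h''"

definition exact_functor ::
  "('o, 'm, 'y) triangulated_cat_scheme \<Rightarrow> ('p, 'n, 'z) triangulated_cat_scheme \<Rightarrow>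
    ('o \<Rightarrow> 'p) \<Rightarrow> ('m \<Rightarrow> 'n) \<Rightarrow> bool" where
  "exact_functor K L Fo Fa \<longleftrightarrow> additive_functor K L Fo Fa \<and>
    (\<exists>\<theta>. natural_iso K L (Fo \<circ> ShO K) (Fa \<circ> ShA K) (ShO L \<circ> Fo) (ShA L \<circ> Fa) \<theta> \<and>
      (\<forall>X Y Z f g h. dist_triangle K X Y Z f g h \<longrightarrow>
        dist_triangle L (Fo X) (Fo Y) (Fo Z) (Fa f) (Fa g) (\<theta> X \<cdot>\<^bsub>L\<^esub> Fa h)))"


section \<open>Monoidal triangulated categories\<close>

record ('o, 'm) monoidal_triangulated_cat = "('o, 'm) triangulated_cat" +
  TensO :: "'o \<Rightarrow> 'o \<Rightarrow> 'o"  (infixl "\<otimes>\<^sub>o\<index>" 70)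
  TensA :: "'m \<Rightarrow> 'm \<Rightarrow> 'm"  (infixl "\<otimes>\<^sub>a\<index>" 80)
  Unit :: "'o"
  Assoc :: "'o \<Rightarrow> 'o \<Rightarrow> 'o \<Rightarrow> 'm"
  LUnit :: "'o \<Rightarrow> 'm"
  RUnit :: "'o \<Rightarrow> 'm"

locale monoidal_category = category K
  for K :: "('o, 'm, 'z) monoidal_triangulated_cat_scheme" (structure) +
  assumes tensor_functor:
      "cat_functor (product_cat K K) K (\<lambda>(A, B). A \<otimes>\<^sub>o B) (\<lambda>(f, g). f \<otimes>\<^sub>a g)"
    and Unit_Ob: "Unit K \<in> Ob K"
    and associator:
      "natural_iso (product_cat (product_cat K K) K) K
        (\<lambda>((A, B), D). (A \<otimes>\<^sub>o B) \<otimes>\<^sub>o D) (\<lambda>((f, g), h). (f \<otimes>\<^sub>a g) \<otimes>\<^sub>a h)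
        (\<lambda>((A, B), D). A \<otimes>\<^sub>o (B \<otimes>\<^sub>o D)) (\<lambda>((f, g), h). f \<otimes>\<^sub>a (g \<otimes>\<^sub>a h))
        (\<lambda>((A, B), D). Assoc K A B D)"
    and left_unitor:
      "natural_iso K K (\<lambda>A. Unit K \<otimes>\<^sub>o A) (\<lambda>f. Id K (Unit K) \<otimes>\<^sub>a f) (\<lambda>A. A) (\<lambda>f. f) (LUnit K)"
    and right_unitor:
      "natural_iso K K (\<lambda>A. A \<otimes>\<^sub>o Unit K) (\<lambda>f. f \<otimes>\<^sub>a Id K (Unit K)) (\<lambda>A. A) (\<lambda>f. f) (RUnit K)"
    and pentagon: "A \<in> Ob K \<Longrightarrow> B \<in> Ob K \<Longrightarrow> D \<in> Ob K \<Longrightarrow> E \<in> Ob K \<Longrightarrow>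
      Assoc K A B (D \<otimes>\<^sub>o E) \<cdot> Assoc K (A \<otimes>\<^sub>o B) D E =
        (Id K A \<otimes>\<^sub>a Assoc K B D E) \<cdot> Assoc K A (B \<otimes>\<^sub>o D) E \<cdot> (Assoc K A B D \<otimes>\<^sub>a Id K E)"
    and triangle: "A \<in> Ob K \<Longrightarrow> B \<in> Ob K \<Longrightarrow>
      (Id K A \<otimes>\<^sub>a LUnit K B) \<cdot> Assoc K A (Unit K) B = RUnit K A \<otimes>\<^sub>a Id K B"

text \<open>Exactness of the bifunctor means exactness in each variable separately; no
  compatibility (such as the usual sign rule) between the two resulting shift
  isomorphisms is demanded.\<close>

locale monoidal_triangulated_category =
  triangulated_category K + monoidal_category K
  for K :: "('o, 'm, 'z) monoidal_triangulated_cat_scheme" (structure) +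
  assumes tensor_exact_right:
      "A \<in> Ob K \<Longrightarrow> exact_functor K K (\<lambda>B. A \<otimes>\<^sub>o B) (\<lambda>f. Id K A \<otimes>\<^sub>a f)"
    and tensor_exact_left:
      "B \<in> Ob K \<Longrightarrow> exact_functor K K (\<lambda>A. A \<otimes>\<^sub>o B) (\<lambda>f. f \<otimes>\<^sub>a Id K B)"


section \<open>Thick ideals and the Balmer spectrum\<close>

text \<open>Full subcategories are represented by their sets of objects.\<close>

definition full_triangulated_subcategory ::
  "('o, 'm, 'z) triangulated_cat_scheme \<Rightarrow> 'o set \<Rightarrow> bool" where
  "full_triangulated_subcategory K I \<longleftrightarrow> I \<subseteq> Ob K \<and>
    (\<forall>Z. zero_object K Z \<longrightarrow> Z \<in> I) \<and>
    (\<forall>A \<in> I. \<forall>B \<in> Ob K. isomorphic K A B \<longrightarrow> B \<in> I) \<and>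
    (\<forall>A \<in> Ob K. A \<in> I \<longleftrightarrow> ShO K A \<in> I) \<and>
    (\<forall>X Y Z f g h. dist_triangle K X Y Z f g h \<longrightarrow> X \<in> I \<longrightarrow> Y \<in> I \<longrightarrow> Z \<in> I)"

definition thick_ideal ::
  "('o, 'm, 'z) monoidal_triangulated_cat_scheme \<Rightarrow> 'o set \<Rightarrow> bool" where
  "thick_ideal K I \<longleftrightarrow> full_triangulated_subcategory K I \<and>
    (\<forall>S \<in> I. \<forall>A B. is_direct_sum K S A B \<longrightarrow> A \<in> I) \<and>
    (\<forall>A \<in> I. \<forall>B \<in> Ob K. A \<otimes>\<^sub>o\<^bsub>K\<^esub> B \<in> I \<and> B \<otimes>\<^sub>o\<^bsub>K\<^esub> A \<in> I)"

definition proper_thick_ideal ::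
  "('o, 'm, 'z) monoidal_triangulated_cat_scheme \<Rightarrow> 'o set \<Rightarrow> bool" where
  "proper_thick_ideal K I \<longleftrightarrow> thick_ideal K I \<and> I \<noteq> Ob K"

definition tensor_set ::
  "('o, 'm, 'z) monoidal_triangulated_cat_scheme \<Rightarrow> 'o set \<Rightarrow> 'o set \<Rightarrow> 'o set" where
  "tensor_set K I J = {X \<in> Ob K. \<exists>A \<in> I. \<exists>B \<in> J. isomorphic K X (A \<otimes>\<^sub>o\<^bsub>K\<^esub> B)}"

definition prime_ideal ::
  "('o, 'm, 'z) monoidal_triangulated_cat_scheme \<Rightarrow> 'o set \<Rightarrow> bool" where
  "prime_ideal K P \<longleftrightarrow> proper_thick_ideal K P \<and>
    (\<forall>I J. thick_ideal K I \<longrightarrow> thick_ideal K J \<longrightarrow> tensor_set K I J \<subseteq> P \<longrightarrow> I \<subseteq> P \<or> J \<subseteq> P)"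

definition Spc ::
  "('o, 'm, 'z) monoidal_triangulated_cat_scheme \<Rightarrow> 'o set set" where
  "Spc K = {P. prime_ideal K P}"

text \<open>Intersections are taken inside \<open>Ob K\<close>, so the empty intersection is the whole category.\<close>

definition semiprime_ideal ::
  "('o, 'm, 'z) monoidal_triangulated_cat_scheme \<Rightarrow> 'o set \<Rightarrow> bool" where
  "semiprime_ideal K P \<longleftrightarrow> (\<exists>\<S>. \<S> \<subseteq> Spc K \<and> P = Ob K \<inter> \<Inter>\<S>)"

end

theory Submission
  imports Defs
begin

text \<open>Ideals generated by objects are never needed: for a thick ideal \<open>P\<close>, the objects \<open>X\<close> with
  \<open>X \<otimes> C \<otimes> B \<in> P\<close> for all \<open>C\<close> and all \<open>B\<close> in a given set form a thick ideal, since tensoring is exact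
  in each variable, and the same holds on the other side. Applying these two residuals in
  succession to a pair \<open>A, B\<close> with \<open>A \<otimes> C \<otimes> B \<in> P\<close> for all \<open>C\<close> produces thick ideals \<open>I \<ni> A\<close>, \<open>J \<ni> B\<close>
  with \<open>I \<otimes> J \<subseteq> P\<close>, which gives (a). Moreover, both residuals contain \<open>P\<close>; hence an ideal maximal
  among those avoiding a sequence with \<open>A\<^sub>n\<^sub>+\<^sub>1 \<cong> A\<^sub>n \<otimes> C\<^sub>n \<otimes> A\<^sub>n\<close> is prime. Such a sequence outside \<open>P\<close>
  starts at every object outside an ideal \<open>P\<close> as in (b), and the constant sequence at the unit
  object gives (c).\<close>


section \<open>Isomorphisms and zero objects\<close>

lemma is_direct_sumE:
  assumes "is_direct_sum C S A B"
  obtains i j p q where "S \<in> Ob C" "A \<in> Ob C" "B \<in> Ob C"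
    "i \<in> Hom C A S" "j \<in> Hom C B S" "p \<in> Hom C S A" "q \<in> Hom C S B"
    "p \<cdot>\<^bsub>C\<^esub> i = Id C A" "q \<cdot>\<^bsub>C\<^esub> j = Id C B"
    "q \<cdot>\<^bsub>C\<^esub> i = Zero C A B" "p \<cdot>\<^bsub>C\<^esub> j = Zero C B A"
    "Add C (i \<cdot>\<^bsub>C\<^esub> p) (j \<cdot>\<^bsub>C\<^esub> q) = Id C S"
  using assms unfolding is_direct_sum_def by blast

lemma is_direct_sum_Ob: "is_direct_sum C S A B \<Longrightarrow> A \<in> Ob C"
  by (simp add: is_direct_sum_def)

context category
begin

lemma isomorphic_iff:
  "isomorphic C A B \<longleftrightarrow>
    (\<exists>f \<in> Hom C A B. \<exists>g \<in> Hom C B A. g \<cdot> f = Id C A \<and> f \<cdot> g = Id C B)"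
  unfolding isomorphic_def is_iso_def by (auto simp: Hom_def)

lemma isomorphic_sym: "isomorphic C A B \<Longrightarrow> isomorphic C B A"
  unfolding isomorphic_iff by blast

lemma isomorphic_trans:
  assumes "isomorphic C A B" "isomorphic C B D"
  shows "isomorphic C A D"
proof -
  obtain f g where f: "f \<in> Hom C A B" and g: "g \<in> Hom C B A"
    and fg: "g \<cdot> f = Id C A" "f \<cdot> g = Id C B"
    using assms(1) unfolding isomorphic_iff by blast
  obtain h k where h: "h \<in> Hom C B D" and k: "k \<in> Hom C D B"
    and hk: "k \<cdot> h = Id C B" "h \<cdot> k = Id C D"
    using assms(2) unfolding isomorphic_iff by blast
  have hf: "h \<cdot> f \<in> Hom C A D" and gk: "g \<cdot> k \<in> Hom C D A"
    using f g h k by (auto intro: Comp_Hom)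
  have "(g \<cdot> k) \<cdot> (h \<cdot> f) = g \<cdot> (k \<cdot> (h \<cdot> f))"
    by (rule Comp_assoc[OF hf k g])
  also have "k \<cdot> (h \<cdot> f) = f"
    using Comp_assoc[OF f h k] hk Id_Comp[OF f] by simp
  finally have 1: "(g \<cdot> k) \<cdot> (h \<cdot> f) = Id C A" using fg by simp
  have "(h \<cdot> f) \<cdot> (g \<cdot> k) = h \<cdot> (f \<cdot> (g \<cdot> k))"
    by (rule Comp_assoc[OF gk f h])
  also have "f \<cdot> (g \<cdot> k) = k"
    using Comp_assoc[OF k g f] fg Id_Comp[OF k] by simp
  finally have 2: "(h \<cdot> f) \<cdot> (g \<cdot> k) = Id C D" using hk by simp
  show ?thesis unfolding isomorphic_iff using hf gk 1 2 by blast
qed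

end

lemma (in cat_functor) functor_isomorphic:
  assumes "isomorphic C A B"
  shows "isomorphic D (Fo A) (Fo B)"
proof -
  obtain f g where f: "f \<in> Hom C A B" and g: "g \<in> Hom C B A"
    and fg: "g \<cdot>\<^bsub>C\<^esub> f = Id C A" "f \<cdot>\<^bsub>C\<^esub> g = Id C B"
    using assms unfolding C.isomorphic_iff by blast
  have "A \<in> Ob C" "B \<in> Ob C"
    using f C.Dom_Ob C.Cod_Ob by (auto simp: Hom_def)
  then have "Fa g \<cdot>\<^bsub>D\<^esub> Fa f = Id D (Fo A)" "Fa f \<cdot>\<^bsub>D\<^esub> Fa g = Id D (Fo B)"
    using Fa_Comp[OF f g] Fa_Comp[OF g f] fg Fa_Id by simp_all
  then show ?thesis
    unfolding D.isomorphic_iff using Fa_Hom[OF f] Fa_Hom[OF g] by blast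
qed

lemma (in natural_iso) component_isomorphic:
  "A \<in> Ob C \<Longrightarrow> isomorphic D (Fo A) (Go A)"
  unfolding isomorphic_def using component_Hom component_iso by blast

section \<open>Zero arrows and zero objects in additive categories\<close>

context additive_category
begin

lemma Zero_Hom: "A \<in> Ob C \<Longrightarrow> B \<in> Ob C \<Longrightarrow> Zero C A B \<in> Hom C A B"
  using comm_group.axioms(2)[OF hom_comm_group, THEN group.is_monoid, THEN monoid.one_closed]
  by (simp add: hom_group_def)

lemma Add_Zero_Zero:
  assumes "A \<in> Ob C" "B \<in> Ob C"
  shows "Add C (Zero C A B) (Zero C A B) = Zero C A B"
proof -
  interpret G: comm_group "hom_group C A B" using hom_comm_group assms .
  show ?thesis using G.l_one[OF G.one_closed] by (simp add: hom_group_def)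
qed

text \<open>Cancellation in the Hom group. Bilinearity of composition and additivity of functors
  both turn 0 + 0 = 0 into this idempotency, which is how composites with zero arrows and images of
  zero arrows are recognised as zero.\<close>

lemma eq_Zero_if_Add_idem:
  assumes "f \<in> Hom C A B" "Add C f f = f"
  shows "f = Zero C A B"
proof -
  have "A \<in> Ob C" "B \<in> Ob C"
    using assms Dom_Ob Cod_Ob by (auto simp: Hom_def)
  then interpret G: comm_group "hom_group C A B" using hom_comm_group by blast
  show ?thesis
    using G.l_cancel_one[of f f] assms by (simp add: hom_group_def)
qed

lemma Zero_Comp:
  assumes "f \<in> Hom C A B" "D \<in> Ob C"
  shows "Zero C B D \<cdot> f = Zero C A D"
proof -
  have B: "B \<in> Ob C" using assms Cod_Ob by (auto simp: Hom_def)
  note z = Zero_Hom[OF B assms(2)]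
  show ?thesis
    using Comp_Add[OF assms(1) z z] Add_Zero_Zero[OF B assms(2)] Comp_Hom[OF assms(1) z]
    by (intro eq_Zero_if_Add_idem) auto
qed

lemma Comp_Zero:
  assumes "f \<in> Hom C A B" "D \<in> Ob C"
  shows "f \<cdot> Zero C D A = Zero C D B"
proof -
  have A: "A \<in> Ob C" using assms Dom_Ob by (auto simp: Hom_def)
  note z = Zero_Hom[OF assms(2) A]
  show ?thesis
    using Add_Comp[OF z z assms(1)] Add_Zero_Zero[OF assms(2) A] Comp_Hom[OF z assms(1)]
    by (intro eq_Zero_if_Add_idem) auto
qed

text \<open>Every arrow into or out of \<open>Z\<close> can be composed with \<open>Id C Z\<close>,
  so it vanishes once this identity does. Unlike the universal property, the equation is visibly
  preserved by additive functors.\<close>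

lemma zero_object_iff: "zero_object C Z \<longleftrightarrow> Z \<in> Ob C \<and> Id C Z = Zero C Z Z"
proof
  assume "zero_object C Z"
  then show "Z \<in> Ob C \<and> Id C Z = Zero C Z Z"
    unfolding zero_object_def using Id_Hom Zero_Hom by blast
next
  assume Z: "Z \<in> Ob C \<and> Id C Z = Zero C Z Z"
  have "f = Zero C A Z" if "f \<in> Hom C A Z" for f A
    using Id_Comp[OF that] Zero_Comp[OF that] Z by simp
  moreover have "f = Zero C Z A" if "f \<in> Hom C Z A" for f A
    using Comp_Id[OF that] Comp_Zero[OF that] Z by simp
  ultimately show "zero_object C Z"
    unfolding zero_object_def using Z Zero_Hom by blast
qed

text \<open>The identity of \<open>A\<close> factors through a zero object, so it is a zero arrow.
  Closure of zero objects under isomorphisms, direct summands and cones all reduces to this.\<close>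

lemma zero_object_factor:
  assumes "zero_object C Z" "f \<in> Hom C A Z" "g \<in> Hom C Z A" "g \<cdot> f = Id C A"
  shows "zero_object C A"
proof -
  have A: "A \<in> Ob C" using assms(2) Dom_Ob by (auto simp: Hom_def)
  have Z: "Z \<in> Ob C" using assms(1) unfolding zero_object_def by blast
  have "f = Zero C A Z"
    using assms(1,2) Zero_Hom[OF A Z] A unfolding zero_object_def by blast
  then show ?thesis
    using assms(3,4) Comp_Zero A by (auto simp: zero_object_iff)
qed

lemma zero_object_isomorphic:
  "zero_object C A \<Longrightarrow> isomorphic C A B \<Longrightarrow> zero_object C B"
  unfolding isomorphic_iff using zero_object_factor by blast

lemma zero_object_summand:
  "zero_object C S \<Longrightarrow> is_direct_sum C S A B \<Longrightarrow> zero_object C A"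
  unfolding is_direct_sum_def using zero_object_factor by blast

end

section \<open>Additive functors preserve zero objects and direct sums\<close>

context additive_functor
begin

lemma Fa_Zero:
  assumes "A \<in> Ob C" "B \<in> Ob C"
  shows "Fa (Zero C A B) = Zero D (Fo A) (Fo B)"
proof -
  note z = C.Zero_Hom[OF assms]
  show ?thesis
    using Fa_Add[OF z z] C.Add_Zero_Zero[OF assms] Fa_Hom[OF z]
    by (intro D.eq_Zero_if_Add_idem) auto
qed

lemma functor_zero_object: "zero_object C Z \<Longrightarrow> zero_object D (Fo Z)"
  using Fa_Zero Fa_Id Fo_Ob unfolding C.zero_object_iff D.zero_object_iff by metis

lemma functor_direct_sum:
  assumes "is_direct_sum C S A B"
  shows "is_direct_sum D (Fo S) (Fo A) (Fo B)"
proof -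
  obtain i j p q where ob: "S \<in> Ob C" "A \<in> Ob C" "B \<in> Ob C"
    and hom: "i \<in> Hom C A S" "j \<in> Hom C B S" "p \<in> Hom C S A" "q \<in> Hom C S B"
    and eq: "p \<cdot>\<^bsub>C\<^esub> i = Id C A" "q \<cdot>\<^bsub>C\<^esub> j = Id C B"
      "q \<cdot>\<^bsub>C\<^esub> i = Zero C A B" "p \<cdot>\<^bsub>C\<^esub> j = Zero C B A"
      "Add C (i \<cdot>\<^bsub>C\<^esub> p) (j \<cdot>\<^bsub>C\<^esub> q) = Id C S"
    using assms by (rule is_direct_sumE)
  have "Fa p \<cdot>\<^bsub>D\<^esub> Fa i = Id D (Fo A)"
    using Fa_Comp[OF hom(1,3)] eq(1) Fa_Id ob by simp
  moreover have "Fa q \<cdot>\<^bsub>D\<^esub> Fa j = Id D (Fo B)"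
    using Fa_Comp[OF hom(2,4)] eq(2) Fa_Id ob by simp
  moreover have "Fa q \<cdot>\<^bsub>D\<^esub> Fa i = Zero D (Fo A) (Fo B)"
    using Fa_Comp[OF hom(1,4)] eq(3) Fa_Zero ob by simp
  moreover have "Fa p \<cdot>\<^bsub>D\<^esub> Fa j = Zero D (Fo B) (Fo A)"
    using Fa_Comp[OF hom(2,3)] eq(4) Fa_Zero ob by simp
  moreover have "Add D (Fa i \<cdot>\<^bsub>D\<^esub> Fa p) (Fa j \<cdot>\<^bsub>D\<^esub> Fa q) = Id D (Fo S)"
    using Fa_Add[OF C.Comp_Hom[OF hom(3,1)] C.Comp_Hom[OF hom(4,2)]]
      Fa_Comp[OF hom(3,1)] Fa_Comp[OF hom(4,2)] eq(5) Fa_Id ob by simp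
  ultimately show ?thesis
    unfolding is_direct_sum_def using hom[THEN Fa_Hom] ob[THEN Fo_Ob] by blast
qed

end

lemma exact_functor_additive: "exact_functor K L Fo Fa \<Longrightarrow> additive_functor K L Fo Fa"
  unfolding exact_functor_def by blast

lemma exact_functor_isomorphic:
  "exact_functor K L Fo Fa \<Longrightarrow> isomorphic K A B \<Longrightarrow> isomorphic L (Fo A) (Fo B)"
  by (meson exact_functor_additive additive_functor.axioms(3) cat_functor.functor_isomorphic)


section \<open>Thick subcategories\<close>

text \<open>The conditions on a thick ideal that do not mention the tensor product. They pass to
  intersections and to preimages under exact functors, from which the residuals below are built;
  closure of the residuals under tensoring is then checked separately.\<close>

definition thick_subcategory ::
  "('o, 'm, 'z) triangulated_cat_scheme \<Rightarrow> 'o set \<Rightarrow> bool" where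
  "thick_subcategory K I \<longleftrightarrow> full_triangulated_subcategory K I \<and>
    (\<forall>S \<in> I. \<forall>A B. is_direct_sum K S A B \<longrightarrow> A \<in> I)"

lemma thick_subcategoryI:
  assumes "I \<subseteq> Ob K"
    and "\<And>Z. zero_object K Z \<Longrightarrow> Z \<in> I"
    and "\<And>A B. A \<in> I \<Longrightarrow> B \<in> Ob K \<Longrightarrow> isomorphic K A B \<Longrightarrow> B \<in> I"
    and "\<And>A. A \<in> Ob K \<Longrightarrow> A \<in> I \<longleftrightarrow> ShO K A \<in> I"
    and "\<And>X Y Z f g h. dist_triangle K X Y Z f g h \<Longrightarrow> X \<in> I \<Longrightarrow> Y \<in> I \<Longrightarrow> Z \<in> I"
    and "\<And>S A B. S \<in> I \<Longrightarrow> is_direct_sum K S A B \<Longrightarrow> A \<in> I"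
  shows "thick_subcategory K I"
  unfolding thick_subcategory_def full_triangulated_subcategory_def using assms
  by (intro conjI ballI allI impI) blast+

lemma thick_subcategoryD:
  assumes "thick_subcategory K I"
  shows "I \<subseteq> Ob K"
    and "zero_object K Z \<Longrightarrow> Z \<in> I"
    and "A \<in> I \<Longrightarrow> B \<in> Ob K \<Longrightarrow> isomorphic K A B \<Longrightarrow> B \<in> I"
    and "A \<in> Ob K \<Longrightarrow> A \<in> I \<longleftrightarrow> ShO K A \<in> I"
    and "dist_triangle K X Y Z f g h \<Longrightarrow> X \<in> I \<Longrightarrow> Y \<in> I \<Longrightarrow> Z \<in> I"
    and "S \<in> I \<Longrightarrow> is_direct_sum K S A B \<Longrightarrow> A \<in> I"
proof -
  note I = assms[unfolded thick_subcategory_def full_triangulated_subcategory_def]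
  show "I \<subseteq> Ob K" using I by (elim conjE)
  show "zero_object K Z \<Longrightarrow> Z \<in> I" using I by (elim conjE) blast
  show "A \<in> I \<Longrightarrow> B \<in> Ob K \<Longrightarrow> isomorphic K A B \<Longrightarrow> B \<in> I" using I by (elim conjE) blast
  show "A \<in> Ob K \<Longrightarrow> A \<in> I \<longleftrightarrow> ShO K A \<in> I" using I by (elim conjE) blast
  show "dist_triangle K X Y Z f g h \<Longrightarrow> X \<in> I \<Longrightarrow> Y \<in> I \<Longrightarrow> Z \<in> I"
    using I by (elim conjE) metis
  show "S \<in> I \<Longrightarrow> is_direct_sum K S A B \<Longrightarrow> A \<in> I" using I by (elim conjE) blast
qed

lemma thick_ideal_iff:
  "thick_ideal K I \<longleftrightarrow> thick_subcategory K I \<and>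
    (\<forall>A \<in> I. \<forall>B \<in> Ob K. A \<otimes>\<^sub>o\<^bsub>K\<^esub> B \<in> I \<and> B \<otimes>\<^sub>o\<^bsub>K\<^esub> A \<in> I)"
  unfolding thick_ideal_def thick_subcategory_def by blast

section \<open>Thick subcategories from zero objects, intersections and preimages\<close>

context triangulated_category
begin

lemma Hom_Ob: "f \<in> Hom K A B \<Longrightarrow> A \<in> Ob K \<and> B \<in> Ob K"
  using Dom_Ob Cod_Ob by (auto simp: Hom_def)

lemma ShO_Ob: "A \<in> Ob K \<Longrightarrow> ShO K A \<in> Ob K"
  using cat_functor.Fo_Ob[OF additive_functor.axioms(3)[OF shift_additive]] .

text \<open>Additive functors preserve zero objects. Conversely the shift, being an equivalence, is
  faithful, so it can identify the identity of \<open>A\<close> with the zero endomorphism only if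
  they are equal.\<close>

lemma zero_object_ShO_iff:
  assumes A: "A \<in> Ob K"
  shows "zero_object K A \<longleftrightarrow> zero_object K (ShO K A)"
proof
  interpret S: additive_functor K K "ShO K" "ShA K" by (rule shift_additive)
  show "zero_object K (ShO K A)" if "zero_object K A"
    using that by (rule S.functor_zero_object)
  assume "zero_object K (ShO K A)"
  then have eq: "ShA K (Id K A) = ShA K (Zero K A A)"
    using S.Fa_Id[OF A] S.Fa_Zero[OF A A] by (simp add: zero_object_iff)
  obtain Go Ga \<eta> where
    "natural_iso K K (\<lambda>A. A) (\<lambda>f. f) (Go \<circ> ShO K) (Ga \<circ> ShA K) \<eta>"
    using shift_equivalence unfolding equivalence_of_cats_def by blast
  then interpret N: natural_iso K K "\<lambda>A. A" "\<lambda>f. f" "Go \<circ> ShO K" "Ga \<circ> ShA K" \<eta> .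
  have \<eta>: "\<eta> A \<in> Hom K A (Go (ShO K A))"
    using N.component_Hom[OF A] by simp
  obtain \<epsilon> where \<epsilon>: "\<epsilon> \<in> Hom K (Go (ShO K A)) A" "\<epsilon> \<cdot> \<eta> A = Id K A"
    using N.component_iso[OF A] \<eta> unfolding is_iso_def by (auto simp: Hom_def)
  \<comment> \<open>\<open>Ga\<close> maps the two sides of \<open>eq\<close> to the same arrow, so
    naturality at \<open>Id K A\<close> and at \<open>Zero K A A\<close> yields the same composite
    with \<open>\<eta> A\<close>, which is then cancelled by its left inverse
    \<open>\<epsilon>\<close>.\<close>
  have "\<eta> A = \<eta> A \<cdot> Zero K A A"
    using N.naturality[OF Id_Hom[OF A]] N.naturality[OF Zero_Hom[OF A A]] eq Comp_Id[OF \<eta>]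
    by simp
  then have "Id K A = Zero K A A"
    using \<epsilon> Comp_Zero[OF \<eta> A] Comp_Zero[OF \<epsilon>(1) A] by simp
  then show "zero_object K A" using A by (simp add: zero_object_iff)
qed

text \<open>Since \<open>g = 0\<close>, the axiom TR3 extends the identity of \<open>Z\<close> to a map from \<open>Y \<rightarrow> Z \<rightarrow> \<Sigma>X\<close> to
  \<open>0 \<rightarrow> Z = Z\<close>, so this identity factors through the zero object \<open>\<Sigma>X\<close>.\<close>

lemma zero_object_cone:
  assumes T: "dist_triangle K X Y Z f g h" and X: "zero_object K X" and Y: "zero_object K Y"
  shows "zero_object K Z"
proof -
  have tri: "is_triangle K X Y Z f g h" using T by (simp add: dist_triangle_def)
  then have g: "g \<in> Hom K Y Z" and h: "h \<in> Hom K Z (ShO K X)" by (auto simp: is_triangle_def)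
  have ob: "Y \<in> Ob K" "Z \<in> Ob K" using Hom_Ob[OF g] by auto
  have X_Ob: "X \<in> Ob K" using X by (simp add: zero_object_def)
  have \<Sigma>Y: "zero_object K (ShO K Y)" and \<Sigma>X: "zero_object K (ShO K X)"
    using X Y zero_object_ShO_iff X_Ob ob by auto
  have \<Sigma>Y_Ob: "ShO K Y \<in> Ob K" and \<Sigma>Z_Ob: "ShO K Z \<in> Ob K" using ob ShO_Ob by auto
  have T1: "dist_triangle K Y Z (ShO K X) g h (Neg K (ShA K f))"
    using TR2[OF tri] T by blast
  interpret S: additive_functor K K "ShO K" "ShA K" by (rule shift_additive)
  let ?z = "Zero K Y Z" and ?w = "Zero K Z (ShO K Y)"
  have tri2: "is_triangle K Y Z Z ?z (Id K Z) ?w"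
    using Zero_Hom Id_Hom ob \<Sigma>Y_Ob by (auto simp: is_triangle_def)
  \<comment> \<open>Rotation replaces the zero arrow by the negative of its shift, which must be a
    zero arrow for the TR1 triangle of \<open>Z\<close> to apply.\<close>
  have neg: "Neg K (ShA K ?z) = Zero K (ShO K Y) (ShO K Z)"
  proof -
    interpret G: comm_group "hom_group K (ShO K Y) (ShO K Z)"
      using hom_comm_group \<Sigma>Y_Ob \<Sigma>Z_Ob .
    have "Zero K (ShO K Y) (ShO K Z) \<in> Hom K (ShO K Y) (ShO K Z)"
      using Zero_Hom \<Sigma>Y_Ob \<Sigma>Z_Ob .
    then show ?thesis
      unfolding Neg_def S.Fa_Zero[OF ob] using G.inv_one
      by (auto simp: Hom_def hom_group_def)
  qed
  \<comment> \<open>The TR1 triangle on \<open>Z\<close> with \<open>ShO K Y\<close> as its zero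
    object. Rotating it back by TR2 gives the triangle that starts at the zero object
    \<open>Y\<close>.\<close>
  have "dist_triangle K Z Z (ShO K Y) (Id K Z) ?w (Neg K (ShA K ?z))"
    unfolding neg by (rule TR1_Id[OF ob(2) \<Sigma>Y])
  then have T2: "dist_triangle K Y Z Z ?z (Id K Z) ?w"
    using TR2[OF tri2] by blast
  have "g = ?z" using Y g Zero_Hom[OF ob] ob unfolding zero_object_def by blast
  then have comm: "Id K Z \<cdot> g = ?z \<cdot> Id K Y"
    using Id_Comp[OF g] Comp_Id[OF g] by simp
  obtain c where c: "c \<in> Hom K (ShO K X) Z" "c \<cdot> h = Id K Z \<cdot> Id K Z"
    using TR3[OF T1 T2 Id_Hom[OF ob(1)] Id_Hom[OF ob(2)] comm] by blast
  then have "c \<cdot> h = Id K Z" using Id_Comp[OF Id_Hom[OF ob(2)]] by simp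
  with \<Sigma>X h c(1) show ?thesis by (rule zero_object_factor)
qed

lemma thick_subcategory_zero: "thick_subcategory K {Z. zero_object K Z}"
proof (rule thick_subcategoryI)
  show "{Z. zero_object K Z} \<subseteq> Ob K" by (auto simp: zero_object_def)
qed (use zero_object_isomorphic zero_object_ShO_iff zero_object_cone zero_object_summand
     in \<open>blast+\<close>)

text \<open>The index set is arbitrary; later it consists of pairs of a middle factor and a test
  object. Requiring \<open>X \<in> Ob K\<close> makes the empty family give the whole
  category.\<close>

lemma thick_subcategory_Int:
  assumes "\<And>i. i \<in> T \<Longrightarrow> thick_subcategory K (I i)"
  shows "thick_subcategory K {X \<in> Ob K. \<forall>i \<in> T. X \<in> I i}"
proof (rule thick_subcategoryI)
  show "Z \<in> {X \<in> Ob K. \<forall>i \<in> T. X \<in> I i}" if "zero_object K Z" for Z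
    using that thick_subcategoryD(2)[OF assms] by (auto simp: zero_object_def)
  show "B \<in> {X \<in> Ob K. \<forall>i \<in> T. X \<in> I i}"
    if "A \<in> {X \<in> Ob K. \<forall>i \<in> T. X \<in> I i}" "B \<in> Ob K" "isomorphic K A B" for A B
    using that thick_subcategoryD(3)[OF assms] by blast
  show "A \<in> {X \<in> Ob K. \<forall>i \<in> T. X \<in> I i} \<longleftrightarrow> ShO K A \<in> {X \<in> Ob K. \<forall>i \<in> T. X \<in> I i}"
    if "A \<in> Ob K" for A
    using that ShO_Ob thick_subcategoryD(4)[OF assms] by blast
  show "Z \<in> {X \<in> Ob K. \<forall>i \<in> T. X \<in> I i}"
    if t: "dist_triangle K X Y Z f g h"
      and "X \<in> {X \<in> Ob K. \<forall>i \<in> T. X \<in> I i}" "Y \<in> {X \<in> Ob K. \<forall>i \<in> T. X \<in> I i}"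
    for X Y Z f g h
  proof -
    have "Z \<in> Ob K"
      using t Hom_Ob unfolding dist_triangle_def is_triangle_def by blast
    then show ?thesis using that thick_subcategoryD(5)[OF assms] by blast
  qed
  show "A \<in> {X \<in> Ob K. \<forall>i \<in> T. X \<in> I i}"
    if "S \<in> {X \<in> Ob K. \<forall>i \<in> T. X \<in> I i}" "is_direct_sum K S A B" for S A B
    using that(1) thick_subcategoryD(6)[OF assms _ that(2)] is_direct_sum_Ob[OF that(2)] by simp
qed blast

text \<open>Additivity carries over zero objects and direct sums, exactness carries over triangles,
  so each closure condition can be tested on images in \<open>I\<close>.\<close>

lemma thick_subcategory_vimage:
  assumes F: "exact_functor K K Fo Fa" and I: "thick_subcategory K I"
  shows "thick_subcategory K {X \<in> Ob K. Fo X \<in> I}"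
proof -
  interpret F: additive_functor K K Fo Fa
    using F by (rule exact_functor_additive)
  obtain \<theta> where \<theta>: "natural_iso K K (Fo \<circ> ShO K) (Fa \<circ> ShA K) (ShO K \<circ> Fo) (ShA K \<circ> Fa) \<theta>"
    and tri: "\<And>X Y Z f g h. dist_triangle K X Y Z f g h \<Longrightarrow>
      dist_triangle K (Fo X) (Fo Y) (Fo Z) (Fa f) (Fa g) (\<theta> X \<cdot> Fa h)"
    using F unfolding exact_functor_def by blast
  show ?thesis
  proof (rule thick_subcategoryI)
    show "Z \<in> {X \<in> Ob K. Fo X \<in> I}" if "zero_object K Z" for Z
      using that F.functor_zero_object thick_subcategoryD(2)[OF I] by (auto simp: zero_object_def)
    show "B \<in> {X \<in> Ob K. Fo X \<in> I}"
      if "A \<in> {X \<in> Ob K. Fo X \<in> I}" "B \<in> Ob K" "isomorphic K A B" for A B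
      using that F.functor_isomorphic F.Fo_Ob thick_subcategoryD(3)[OF I] by blast
    show "A \<in> {X \<in> Ob K. Fo X \<in> I} \<longleftrightarrow> ShO K A \<in> {X \<in> Ob K. Fo X \<in> I}"
      if A: "A \<in> Ob K" for A
    proof -
      \<comment> \<open>\<open>Fo\<close> commutes with the shift only up to the isomorphism
        \<open>\<theta> A\<close>, so the two objects are compared through closure of
        \<open>I\<close> under isomorphism.\<close>
      have "isomorphic K (Fo (ShO K A)) (ShO K (Fo A))"
        using natural_iso.component_isomorphic[OF \<theta> A] by simp
      then have "Fo (ShO K A) \<in> I \<longleftrightarrow> ShO K (Fo A) \<in> I"
        using thick_subcategoryD(3)[OF I] isomorphic_sym ShO_Ob F.Fo_Ob A by meson
      then show ?thesis
        using A ShO_Ob F.Fo_Ob thick_subcategoryD(4)[OF I] by simp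
    qed
    show "Z \<in> {X \<in> Ob K. Fo X \<in> I}"
      if t: "dist_triangle K X Y Z f g h"
        and "X \<in> {X \<in> Ob K. Fo X \<in> I}" "Y \<in> {X \<in> Ob K. Fo X \<in> I}" for X Y Z f g h
    proof -
      have "Z \<in> Ob K"
        using t Hom_Ob unfolding dist_triangle_def is_triangle_def by blast
      then show ?thesis using that thick_subcategoryD(5)[OF I tri[OF t]] by blast
    qed
    show "A \<in> {X \<in> Ob K. Fo X \<in> I}"
      if "S \<in> {X \<in> Ob K. Fo X \<in> I}" "is_direct_sum K S A B" for S A B
      using that(1) thick_subcategoryD(6)[OF I _ F.functor_direct_sum[OF that(2)]]
        is_direct_sum_Ob[OF that(2)] by simp
  qed blast
qed

end


section \<open>Thick ideals and primes\<close>

context monoidal_triangulated_category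
begin

lemma tensor_Ob: "A \<in> Ob K \<Longrightarrow> B \<in> Ob K \<Longrightarrow> A \<otimes>\<^sub>o B \<in> Ob K"
  using cat_functor.Fo_Ob[OF tensor_functor, of "(A, B)"] by (simp add: product_cat_def)

lemma tensor_isomorphic_left:
  "isomorphic K A A' \<Longrightarrow> B \<in> Ob K \<Longrightarrow> isomorphic K (A \<otimes>\<^sub>o B) (A' \<otimes>\<^sub>o B)"
  using exact_functor_isomorphic[OF tensor_exact_left] .

lemma tensor_assoc_isomorphic:
  "A \<in> Ob K \<Longrightarrow> B \<in> Ob K \<Longrightarrow> D \<in> Ob K \<Longrightarrow>
    isomorphic K (A \<otimes>\<^sub>o B \<otimes>\<^sub>o D) (A \<otimes>\<^sub>o (B \<otimes>\<^sub>o D))"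
  using natural_iso.component_isomorphic[OF associator, of "((A, B), D)"]
  by (simp add: product_cat_def)

lemma Unit_tensor_isomorphic: "A \<in> Ob K \<Longrightarrow> isomorphic K (Unit K \<otimes>\<^sub>o A) A"
  using natural_iso.component_isomorphic[OF left_unitor] .

lemma tensor_Unit_isomorphic: "A \<in> Ob K \<Longrightarrow> isomorphic K (A \<otimes>\<^sub>o Unit K) A"
  using natural_iso.component_isomorphic[OF right_unitor] .

lemma thick_ideal_subset: "thick_ideal K P \<Longrightarrow> P \<subseteq> Ob K"
  unfolding thick_ideal_iff using thick_subcategoryD(1) by blast

lemma thick_ideal_tensor:
  assumes "thick_ideal K P" "A \<in> P" "B \<in> Ob K"
  shows "A \<otimes>\<^sub>o B \<in> P" "B \<otimes>\<^sub>o A \<in> P"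
  using assms unfolding thick_ideal_iff by blast+

lemma thick_ideal_isomorphic:
  assumes "thick_ideal K P" "isomorphic K A B"
  shows "A \<in> P \<longleftrightarrow> B \<in> P"
proof -
  have "A \<in> Ob K \<and> B \<in> Ob K" using assms(2) Hom_Ob unfolding isomorphic_def by blast
  then show ?thesis
    using assms isomorphic_sym thick_subcategoryD(3) unfolding thick_ideal_iff by metis
qed

lemma thick_ideal_zero: "thick_ideal K {Z. zero_object K Z}"
  unfolding thick_ideal_iff
proof (intro conjI ballI thick_subcategory_zero)
  fix Z B assume Z: "Z \<in> {Z. zero_object K Z}" and B: "B \<in> Ob K"
  show "Z \<otimes>\<^sub>o B \<in> {Z. zero_object K Z}"
    using Z additive_functor.functor_zero_object[OF exact_functor_additive[OF tensor_exact_left[OF B]]]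
    by simp
  show "B \<otimes>\<^sub>o Z \<in> {Z. zero_object K Z}"
    using Z additive_functor.functor_zero_object[OF exact_functor_additive[OF tensor_exact_right[OF B]]]
    by simp
qed

text \<open>Closure under cones is the one condition with two members of the ideal as premises, and
  in a chain both lie in a single ideal. The other conditions concern one object at a time; zero
  objects lie in any member of the nonempty chain.\<close>

lemma thick_ideal_Union_chain:
  assumes ne: "\<C> \<noteq> {}" and ch: "subset.chain \<A> \<C>" and id: "\<And>I. I \<in> \<A> \<Longrightarrow> thick_ideal K I"
  shows "thick_ideal K (\<Union>\<C>)"
proof -
  have idC: "thick_ideal K I" if "I \<in> \<C>" for I
    using that ch id unfolding subset.chain_def by blast
  have lin: "I \<subseteq> J \<or> J \<subseteq> I" if "I \<in> \<C>" "J \<in> \<C>" for I J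
    using that ch unfolding subset_chain_def by blast
  have thC: "thick_subcategory K I" if "I \<in> \<C>" for I
    using idC[OF that] by (simp add: thick_ideal_iff)
  have "thick_subcategory K (\<Union>\<C>)"
  proof (rule thick_subcategoryI)
    show "\<Union>\<C> \<subseteq> Ob K" using idC thick_ideal_subset by blast
    show "Z \<in> \<Union>\<C>" if "zero_object K Z" for Z
      using that ne thick_subcategoryD(2)[OF thC] by blast
    show "B \<in> \<Union>\<C>" if "A \<in> \<Union>\<C>" "B \<in> Ob K" "isomorphic K A B" for A B
      using that thick_subcategoryD(3)[OF thC] by blast
    show "A \<in> \<Union>\<C> \<longleftrightarrow> ShO K A \<in> \<Union>\<C>" if "A \<in> Ob K" for A
      using that thick_subcategoryD(4)[OF thC] by blast
    show "Z \<in> \<Union>\<C>"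
      if t: "dist_triangle K X Y Z f g h" and XY: "X \<in> \<Union>\<C>" "Y \<in> \<Union>\<C>" for X Y Z f g h
    proof -
      obtain I J where "I \<in> \<C>" "X \<in> I" "J \<in> \<C>" "Y \<in> J"
        using XY by (elim UnionE)
      then obtain L where "L \<in> \<C>" "X \<in> L" "Y \<in> L" using lin by blast
      then show ?thesis using thick_subcategoryD(5)[OF thC t] by blast
    qed
    show "A \<in> \<Union>\<C>" if "S \<in> \<Union>\<C>" "is_direct_sum K S A B" for S A B
      using that thick_subcategoryD(6)[OF thC] by blast
  qed
  moreover have "A \<otimes>\<^sub>o B \<in> \<Union>\<C> \<and> B \<otimes>\<^sub>o A \<in> \<Union>\<C>" if "A \<in> \<Union>\<C>" "B \<in> Ob K" for A B
    using that thick_ideal_tensor[OF idC] by blast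
  ultimately show ?thesis unfolding thick_ideal_iff by blast
qed

section \<open>Residuals of thick ideals\<close>

text \<open>The analogue of an ideal quotient in a noncommutative ring. The free middle factor
  \<open>C\<close> is what makes the result closed under tensoring from the right. Products are
  bracketed to the left.\<close>

definition left_residual :: "'o set \<Rightarrow> 'o set \<Rightarrow> 'o set" where
  "left_residual P S = {X \<in> Ob K. \<forall>C \<in> Ob K. \<forall>B \<in> S. X \<otimes>\<^sub>o C \<otimes>\<^sub>o B \<in> P}"

definition right_residual :: "'o set \<Rightarrow> 'o set \<Rightarrow> 'o set" where
  "right_residual P S = {Y \<in> Ob K. \<forall>C \<in> Ob K. \<forall>A \<in> S. A \<otimes>\<^sub>o C \<otimes>\<^sub>o Y \<in> P}"

text \<open>For fixed \<open>C\<close> and \<open>B\<close> the condition is a preimage of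
  \<open>P\<close> under two exact functors in succession, tensoring with \<open>C\<close> and then
  with \<open>B\<close>; the residual is the intersection of these preimages. A factor to the right
  of \<open>X\<close> merges with \<open>C\<close>, a factor to its left is absorbed by
  \<open>P\<close>, each after reassociating.\<close>

lemma thick_ideal_left_residual:
  assumes P: "thick_ideal K P" and S: "S \<subseteq> Ob K"
  shows "thick_ideal K (left_residual P S)"
  unfolding thick_ideal_iff
proof (intro conjI ballI)
  have "thick_subcategory K {X \<in> Ob K. X \<otimes>\<^sub>o C \<in> {Y \<in> Ob K. Y \<otimes>\<^sub>o B \<in> P}}"
    if "C \<in> Ob K" "B \<in> S" for C B
    using thick_subcategory_vimage[OF tensor_exact_left thick_subcategory_vimage[OF tensor_exact_left]]
      that P S unfolding thick_ideal_iff by blast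
  then have "thick_subcategory K
      {X \<in> Ob K. \<forall>i \<in> Ob K \<times> S. X \<in> {X \<in> Ob K. X \<otimes>\<^sub>o fst i \<in> {Y \<in> Ob K. Y \<otimes>\<^sub>o snd i \<in> P}}}"
    by (intro thick_subcategory_Int) auto
  also have "{X \<in> Ob K. \<forall>i \<in> Ob K \<times> S. X \<in> {X \<in> Ob K. X \<otimes>\<^sub>o fst i \<in> {Y \<in> Ob K. Y \<otimes>\<^sub>o snd i \<in> P}}}
      = left_residual P S"
    using tensor_Ob by (auto simp: left_residual_def)
  finally show "thick_subcategory K (left_residual P S)" .
next
  fix X D assume X: "X \<in> left_residual P S" and D: "D \<in> Ob K"
  then have X_Ob: "X \<in> Ob K" by (simp add: left_residual_def)
  have "X \<otimes>\<^sub>o D \<otimes>\<^sub>o C \<otimes>\<^sub>o B \<in> P" if C: "C \<in> Ob K" and B: "B \<in> S" for C B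
  proof -
    have "X \<otimes>\<^sub>o (D \<otimes>\<^sub>o C) \<otimes>\<^sub>o B \<in> P"
      using X B tensor_Ob[OF D C] by (simp add: left_residual_def)
    then show ?thesis
      using thick_ideal_isomorphic[OF P tensor_isomorphic_left[OF tensor_assoc_isomorphic]]
        X_Ob D C B S by blast
  qed
  then show "X \<otimes>\<^sub>o D \<in> left_residual P S"
    using tensor_Ob X_Ob D by (simp add: left_residual_def)
  have "D \<otimes>\<^sub>o X \<otimes>\<^sub>o C \<otimes>\<^sub>o B \<in> P" if C: "C \<in> Ob K" and B: "B \<in> S" for C B
  proof -
    have B_Ob: "B \<in> Ob K" using B S by blast
    have "X \<otimes>\<^sub>o C \<otimes>\<^sub>o B \<in> P" using X B C by (simp add: left_residual_def)
    then have "D \<otimes>\<^sub>o (X \<otimes>\<^sub>o C \<otimes>\<^sub>o B) \<in> P" using thick_ideal_tensor P D by blast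
    then have "D \<otimes>\<^sub>o (X \<otimes>\<^sub>o C) \<otimes>\<^sub>o B \<in> P"
      using thick_ideal_isomorphic[OF P tensor_assoc_isomorphic] X_Ob D C B_Ob tensor_Ob by blast
    then show ?thesis
      using thick_ideal_isomorphic[OF P tensor_isomorphic_left[OF tensor_assoc_isomorphic]]
        X_Ob D C B_Ob by blast
  qed
  then show "D \<otimes>\<^sub>o X \<in> left_residual P S"
    using tensor_Ob X_Ob D by (simp add: left_residual_def)
qed

text \<open>With left bracketing \<open>Y\<close> is simply the last factor, so one preimage under
  tensoring with \<open>A \<otimes> C\<close> suffices. Now a factor to the left of \<open>Y\<close>
  merges with \<open>C\<close> and a factor to its right is absorbed by \<open>P\<close>.\<close>

lemma thick_ideal_right_residual:
  assumes P: "thick_ideal K P" and S: "S \<subseteq> Ob K"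
  shows "thick_ideal K (right_residual P S)"
  unfolding thick_ideal_iff
proof (intro conjI ballI)
  have "thick_subcategory K {Y \<in> Ob K. A \<otimes>\<^sub>o C \<otimes>\<^sub>o Y \<in> P}" if "C \<in> Ob K" "A \<in> S" for C A
    using thick_subcategory_vimage[OF tensor_exact_right] tensor_Ob
      that P S unfolding thick_ideal_iff by blast
  then have "thick_subcategory K
      {Y \<in> Ob K. \<forall>i \<in> Ob K \<times> S. Y \<in> {Y \<in> Ob K. snd i \<otimes>\<^sub>o fst i \<otimes>\<^sub>o Y \<in> P}}"
    by (intro thick_subcategory_Int) auto
  also have "{Y \<in> Ob K. \<forall>i \<in> Ob K \<times> S. Y \<in> {Y \<in> Ob K. snd i \<otimes>\<^sub>o fst i \<otimes>\<^sub>o Y \<in> P}}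
      = right_residual P S"
    by (auto simp: right_residual_def)
  finally show "thick_subcategory K (right_residual P S)" .
next
  fix Y D assume Y: "Y \<in> right_residual P S" and D: "D \<in> Ob K"
  then have Y_Ob: "Y \<in> Ob K" by (simp add: right_residual_def)
  have "A \<otimes>\<^sub>o C \<otimes>\<^sub>o (Y \<otimes>\<^sub>o D) \<in> P" if C: "C \<in> Ob K" and A: "A \<in> S" for C A
  proof -
    have A_Ob: "A \<in> Ob K" using A S by blast
    have "A \<otimes>\<^sub>o C \<otimes>\<^sub>o Y \<in> P" using Y A C by (simp add: right_residual_def)
    then have "A \<otimes>\<^sub>o C \<otimes>\<^sub>o Y \<otimes>\<^sub>o D \<in> P" using thick_ideal_tensor P D by blast
    then show ?thesis
      using thick_ideal_isomorphic[OF P tensor_assoc_isomorphic] Y_Ob D C A_Ob tensor_Ob by blast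
  qed
  then show "Y \<otimes>\<^sub>o D \<in> right_residual P S"
    using tensor_Ob Y_Ob D by (simp add: right_residual_def)
  have "A \<otimes>\<^sub>o C \<otimes>\<^sub>o (D \<otimes>\<^sub>o Y) \<in> P" if C: "C \<in> Ob K" and A: "A \<in> S" for C A
  proof -
    have A_Ob: "A \<in> Ob K" using A S by blast
    have "A \<otimes>\<^sub>o (C \<otimes>\<^sub>o D) \<otimes>\<^sub>o Y \<in> P"
      using Y A tensor_Ob[OF C D] by (simp add: right_residual_def)
    then have "A \<otimes>\<^sub>o C \<otimes>\<^sub>o D \<otimes>\<^sub>o Y \<in> P"
      using thick_ideal_isomorphic[OF P tensor_isomorphic_left[OF tensor_assoc_isomorphic]]
        Y_Ob D C A_Ob by blast
    then show ?thesis
      using thick_ideal_isomorphic[OF P tensor_assoc_isomorphic] Y_Ob D C A_Ob tensor_Ob by blast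
  qed
  then show "D \<otimes>\<^sub>o Y \<in> right_residual P S"
    using tensor_Ob Y_Ob D by (simp add: right_residual_def)
qed

lemma subset_left_residual:
  assumes "thick_ideal K P" "S \<subseteq> Ob K"
  shows "P \<subseteq> left_residual P S"
  using assms thick_ideal_subset[OF assms(1)] thick_ideal_tensor(1)[OF assms(1)]
  by (auto simp: left_residual_def subset_iff)

lemma subset_right_residual:
  assumes "thick_ideal K P" "S \<subseteq> Ob K"
  shows "P \<subseteq> right_residual P S"
  using assms thick_ideal_subset[OF assms(1)] thick_ideal_tensor(2)[OF assms(1)] tensor_Ob
  by (auto simp: right_residual_def subset_iff)

text \<open>Enlarges a pair of objects to a pair of ideals with the same product property. That both
  contain \<open>P\<close> is what makes them comparable with a maximal ideal later on.\<close>

lemma residual_ideals: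
  assumes P: "thick_ideal K P" and A: "A \<in> Ob K" and B: "B \<in> Ob K"
    and AB: "\<And>C. C \<in> Ob K \<Longrightarrow> A \<otimes>\<^sub>o C \<otimes>\<^sub>o B \<in> P"
  obtains I J where "thick_ideal K I" "thick_ideal K J" "P \<subseteq> I" "P \<subseteq> J" "A \<in> I" "B \<in> J"
    "\<And>X C Y. X \<in> I \<Longrightarrow> C \<in> Ob K \<Longrightarrow> Y \<in> J \<Longrightarrow> X \<otimes>\<^sub>o C \<otimes>\<^sub>o Y \<in> P"
proof
  let ?I = "left_residual P {B}"
  \<comment> \<open>The residual of all of \<open>?I\<close>, not only of \<open>{A}\<close>, so
    that the product property holds for every pair from the two ideals. \<open>B\<close> still
    qualifies because \<open>?I\<close> was defined by testing against \<open>B\<close>.\<close>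
  let ?J = "right_residual P ?I"
  show I: "thick_ideal K ?I" using thick_ideal_left_residual P B by simp
  show "thick_ideal K ?J" using thick_ideal_right_residual P thick_ideal_subset[OF I] .
  show "P \<subseteq> ?I" using subset_left_residual P B by simp
  show "P \<subseteq> ?J" using subset_right_residual P thick_ideal_subset[OF I] .
  show "A \<in> ?I" using A AB by (simp add: left_residual_def)
  show "B \<in> ?J" using B by (simp add: left_residual_def right_residual_def)
  show "X \<otimes>\<^sub>o C \<otimes>\<^sub>o Y \<in> P" if "X \<in> ?I" "C \<in> Ob K" "Y \<in> ?J" for X C Y
    using that by (simp add: right_residual_def)
qed

section \<open>Criteria in terms of objects, and existence of primes\<close>

lemma prime_ideal_iff:
  assumes proper: "proper_thick_ideal K P"
  shows "prime_ideal K P \<longleftrightarrow>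
    (\<forall>A \<in> Ob K. \<forall>B \<in> Ob K. (\<forall>C \<in> Ob K. A \<otimes>\<^sub>o C \<otimes>\<^sub>o B \<in> P) \<longrightarrow> A \<in> P \<or> B \<in> P)"
    (is "_ \<longleftrightarrow> ?R")
proof
  have P: "thick_ideal K P" using proper by (simp add: proper_thick_ideal_def)
  assume prime: "prime_ideal K P"
  show ?R
  proof (intro ballI impI)
    fix A B assume A: "A \<in> Ob K" and B: "B \<in> Ob K" and AB: "\<forall>C \<in> Ob K. A \<otimes>\<^sub>o C \<otimes>\<^sub>o B \<in> P"
    obtain I J where IJ: "thick_ideal K I" "thick_ideal K J" "A \<in> I" "B \<in> J"
      and tens: "\<And>X C Y. X \<in> I \<Longrightarrow> C \<in> Ob K \<Longrightarrow> Y \<in> J \<Longrightarrow> X \<otimes>\<^sub>o C \<otimes>\<^sub>o Y \<in> P"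
      using residual_ideals[OF P A B AB[rule_format]] by metis
    have XY: "X \<otimes>\<^sub>o Y \<in> P" if "X \<in> I" "Y \<in> J" for X Y
    proof -
      have "X \<in> Ob K" "Y \<in> Ob K" using that IJ thick_ideal_subset by blast+
      \<comment> \<open>The unit as middle factor reduces the triple product to
        \<open>X \<otimes> Y\<close> up to isomorphism.\<close>
      then show ?thesis
        using tens[OF that(1) Unit_Ob that(2)]
          thick_ideal_isomorphic[OF P tensor_isomorphic_left[OF tensor_Unit_isomorphic]] by blast
    qed
    have "tensor_set K I J \<subseteq> P"
      unfolding tensor_set_def using XY thick_ideal_isomorphic[OF P] by blast
    then show "A \<in> P \<or> B \<in> P"
      using prime IJ unfolding prime_ideal_def by blast
  qed
next
  assume R: ?R
  have "I \<subseteq> P \<or> J \<subseteq> P"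
    if I: "thick_ideal K I" and J: "thick_ideal K J" and IJ: "tensor_set K I J \<subseteq> P" for I J
  proof (rule ccontr)
    assume "\<not> ?thesis"
    then obtain A B where A: "A \<in> I" "A \<notin> P" and B: "B \<in> J" "B \<notin> P" by blast
    have ob: "A \<in> Ob K" "B \<in> Ob K" using A B I J thick_ideal_subset by blast+
    have "A \<otimes>\<^sub>o C \<otimes>\<^sub>o B \<in> P" if C: "C \<in> Ob K" for C
    proof -
      \<comment> \<open>The middle factor is absorbed into \<open>I\<close>, so the triple product
        is an element of \<open>tensor_set K I J\<close>.\<close>
      have AC: "A \<otimes>\<^sub>o C \<in> I" using thick_ideal_tensor(1) I A C by blast
      have X: "A \<otimes>\<^sub>o C \<otimes>\<^sub>o B \<in> Ob K" using tensor_Ob ob C by blast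
      have "isomorphic K (A \<otimes>\<^sub>o C \<otimes>\<^sub>o B) (A \<otimes>\<^sub>o C \<otimes>\<^sub>o B)"
        unfolding isomorphic_iff using Id_Hom[OF X] Comp_Id by blast
      then show ?thesis using IJ AC B X unfolding tensor_set_def by blast
    qed
    then show False using R A B ob by blast
  qed
  then show "prime_ideal K P" using proper unfolding prime_ideal_def by blast
qed

text \<open>The sequence plays the role of an m-system in noncommutative ring theory: an ideal above
  \<open>P\<close> that is maximal among those missing it exists by Zorn's lemma and turns out to be
  prime.\<close>

lemma prime_ideal_avoiding_sequence:
  assumes P: "thick_ideal K P"
    and A: "\<And>n. A n \<in> Ob K" "\<And>n. A n \<notin> P"
    and step: "\<And>n. \<exists>C \<in> Ob K. isomorphic K (A (Suc n)) (A n \<otimes>\<^sub>o C \<otimes>\<^sub>o A n)"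
  obtains Q where "prime_ideal K Q" "P \<subseteq> Q" "\<And>n. A n \<notin> Q"
proof -
  define \<A> where "\<A> = {Q. thick_ideal K Q \<and> P \<subseteq> Q \<and> range A \<inter> Q = {}}"
  have "P \<in> \<A>" using P A by (auto simp: \<A>_def)
  moreover have "\<Union>\<C> \<in> \<A>" if "\<C> \<noteq> {}" "subset.chain \<A> \<C>" for \<C>
  proof -
    have "\<C> \<subseteq> \<A>" using that by (simp add: subset.chain_def)
    moreover have "thick_ideal K (\<Union>\<C>)"
      by (rule thick_ideal_Union_chain[OF that]) (simp add: \<A>_def)
    ultimately show ?thesis using that(1) unfolding \<A>_def by blast
  qed
  ultimately obtain Q where "Q \<in> \<A>" and max: "\<And>I. I \<in> \<A> \<Longrightarrow> Q \<subseteq> I \<Longrightarrow> I = Q"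
    using subset_Zorn_nonempty[of \<A>] by blast
  then have Q: "thick_ideal K Q" "P \<subseteq> Q" and avoid: "\<And>n. A n \<notin> Q"
    unfolding \<A>_def by blast+
  \<comment> \<open>By maximality of \<open>Q\<close>, a properly larger thick ideal must contain a
    term of the sequence.\<close>
  have meets: "\<exists>n. A n \<in> I" if "thick_ideal K I" "Q \<subseteq> I" "X \<in> I" "X \<notin> Q" for I X
    using that max[of I] Q unfolding \<A>_def by blast
  \<comment> \<open>Each term is, up to isomorphism, a tensor multiple of its predecessor, so a
    thick ideal containing one term contains all later ones.\<close>
  have up: "A n \<in> I" if I: "thick_ideal K I" and "A m \<in> I" "m \<le> n" for I m n
    using \<open>m \<le> n\<close>
  proof (induction n rule: dec_induct)
    case base
    show ?case by fact
  next
    case (step n)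
    obtain C where C: "C \<in> Ob K" "isomorphic K (A (Suc n)) (A n \<otimes>\<^sub>o C \<otimes>\<^sub>o A n)"
      using assms(4) by blast
    have "A n \<otimes>\<^sub>o C \<otimes>\<^sub>o A n \<in> I"
      using thick_ideal_tensor(1)[OF I] step.IH C(1) A(1) by blast
    then show ?case using thick_ideal_isomorphic[OF I C(2)] by blast
  qed
  have "proper_thick_ideal K Q"
    using Q A(1) avoid unfolding proper_thick_ideal_def by blast
  moreover have "X \<in> Q \<or> Y \<in> Q"
    if ob: "X \<in> Ob K" "Y \<in> Ob K" and XY: "\<forall>C \<in> Ob K. X \<otimes>\<^sub>o C \<otimes>\<^sub>o Y \<in> Q" for X Y
  proof (rule ccontr)
    assume neither: "\<not> ?thesis"
    obtain I J where IJ: "thick_ideal K I" "thick_ideal K J" "Q \<subseteq> I" "Q \<subseteq> J" "X \<in> I" "Y \<in> J"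
      and tens: "\<And>X C Y. X \<in> I \<Longrightarrow> C \<in> Ob K \<Longrightarrow> Y \<in> J \<Longrightarrow> X \<otimes>\<^sub>o C \<otimes>\<^sub>o Y \<in> Q"
      using residual_ideals[OF Q(1) ob XY[rule_format]] by metis
    obtain m n where mn: "A m \<in> I" "A n \<in> J"
      using meets IJ neither by blast
    \<comment> \<open>The later of the two terms lies in both ideals, and its successor is then a
      product of the form \<open>X \<otimes> C \<otimes> Y\<close> with \<open>X\<close> in
      \<open>I\<close> and \<open>Y\<close> in \<open>J\<close>, hence in \<open>Q\<close>.\<close>
    define k where "k = max m n"
    have k: "A k \<in> I" "A k \<in> J"
      using up[OF IJ(1) mn(1)] up[OF IJ(2) mn(2)] by (simp_all add: k_def)
    obtain C where C: "C \<in> Ob K" "isomorphic K (A (Suc k)) (A k \<otimes>\<^sub>o C \<otimes>\<^sub>o A k)"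
      using step by blast
    have "A (Suc k) \<in> Q"
      using thick_ideal_isomorphic[OF Q(1) C(2)] tens[OF k(1) C(1) k(2)] by blast
    then show False using avoid by blast
  qed
  ultimately have "prime_ideal K Q" using prime_ideal_iff by blast
  then show ?thesis using that Q(2) avoid by blast
qed

text \<open>In one direction the criterion for primes is applied, with both objects equal to
  \<open>A\<close>, to each prime of the family. In the other, a prime above \<open>P\<close> is
  found that omits a given object outside \<open>P\<close>.\<close>

lemma semiprime_ideal_iff:
  assumes proper: "proper_thick_ideal K P"
  shows "semiprime_ideal K P \<longleftrightarrow>
    (\<forall>A \<in> Ob K. (\<forall>C \<in> Ob K. A \<otimes>\<^sub>o C \<otimes>\<^sub>o A \<in> P) \<longrightarrow> A \<in> P)"
    (is "_ \<longleftrightarrow> ?R")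
proof
  assume "semiprime_ideal K P"
  then obtain \<S> where \<S>: "\<S> \<subseteq> Spc K" "P = Ob K \<inter> \<Inter>\<S>"
    unfolding semiprime_ideal_def by blast
  show ?R
  proof (intro ballI impI)
    fix A assume A: "A \<in> Ob K" and AA: "\<forall>C \<in> Ob K. A \<otimes>\<^sub>o C \<otimes>\<^sub>o A \<in> P"
    have "A \<in> Q" if "Q \<in> \<S>" for Q
    proof -
      have Q: "prime_ideal K Q" using that \<S> by (auto simp: Spc_def)
      moreover have "\<forall>C \<in> Ob K. A \<otimes>\<^sub>o C \<otimes>\<^sub>o A \<in> Q" using AA \<S> that by blast
      moreover have "proper_thick_ideal K Q" using Q by (simp add: prime_ideal_def)
      ultimately show ?thesis using prime_ideal_iff A by blast
    qed
    then show "A \<in> P" using \<S> A by blast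
  qed
next
  have P: "thick_ideal K P" using proper by (simp add: proper_thick_ideal_def)
  assume R: ?R
  have sep: "\<exists>Q \<in> Spc K. P \<subseteq> Q \<and> X \<notin> Q" if X: "X \<in> Ob K" "X \<notin> P" for X
  proof -
    \<comment> \<open>The clause guarded by an index equal to 0 pins the first term of the dependent
      choice to \<open>X\<close>. The contrapositive of the hypothesis supplies a next term outside
      \<open>P\<close>.\<close>
    have ex: "\<exists>B. (B \<in> Ob K - P \<and> (Suc n = 0 \<longrightarrow> B = X)) \<and> (\<exists>C \<in> Ob K. B = A \<otimes>\<^sub>o C \<otimes>\<^sub>o A)"
      if "A \<in> Ob K - P \<and> (n = 0 \<longrightarrow> A = X)" for A n
    proof -
      have A: "A \<in> Ob K" "A \<notin> P" using that by auto
      then obtain C where "C \<in> Ob K" "A \<otimes>\<^sub>o C \<otimes>\<^sub>o A \<notin> P" using R by blast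
      then show ?thesis using tensor_Ob A(1) by blast
    qed
    have "\<exists>A. A \<in> Ob K - P \<and> (0 = (0::nat) \<longrightarrow> A = X)" using X by blast
    from dependent_nat_choice[where Q = "\<lambda>_ A B. \<exists>C \<in> Ob K. B = A \<otimes>\<^sub>o C \<otimes>\<^sub>o A", OF this ex]
    obtain A where choice: "\<And>n. A n \<in> Ob K - P \<and> (n = 0 \<longrightarrow> A n = X)"
        "\<And>n. \<exists>C \<in> Ob K. A (Suc n) = A n \<otimes>\<^sub>o C \<otimes>\<^sub>o A n"
      by blast
    then have A: "\<And>n. A n \<in> Ob K \<and> A n \<notin> P" "A 0 = X"
      and step: "\<And>n. \<exists>C \<in> Ob K. A (Suc n) = A n \<otimes>\<^sub>o C \<otimes>\<^sub>o A n"
      by blast+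
    have "isomorphic K (A n) (A n)" for n
      unfolding isomorphic_iff using Id_Hom[of "A n"] Comp_Id A(1) by blast
    then have "\<exists>C \<in> Ob K. isomorphic K (A (Suc n)) (A n \<otimes>\<^sub>o C \<otimes>\<^sub>o A n)" for n
      using step by metis
    then obtain Q where "prime_ideal K Q" "P \<subseteq> Q" "\<And>n. A n \<notin> Q"
      using prime_ideal_avoiding_sequence[OF P, of A] A(1) by blast
    then show ?thesis using A(2) unfolding Spc_def by blast
  qed
  show "semiprime_ideal K P"
    unfolding semiprime_ideal_def
  proof (intro exI conjI)
    \<comment> \<open>The family chosen consists of all primes containing \<open>P\<close>.\<close>
    show "{Q \<in> Spc K. P \<subseteq> Q} \<subseteq> Spc K" by blast
    show "P = Ob K \<inter> \<Inter>{Q \<in> Spc K. P \<subseteq> Q}"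
      using sep thick_ideal_subset[OF P] by blast
  qed
qed

text \<open>The unit is isomorphic to its own triple tensor product, so the constant sequence at it
  satisfies the recursion, starting from the ideal of zero objects. The nonzero object excludes the
  zero category, whose only thick ideal is \<open>Ob K\<close> and which therefore has no
  primes.\<close>

lemma Spc_nonempty:
  assumes "A \<in> Ob K" "\<not> zero_object K A"
  shows "Spc K \<noteq> {}"
proof -
  have "isomorphic K (Unit K \<otimes>\<^sub>o Unit K \<otimes>\<^sub>o Unit K) (Unit K)"
    using isomorphic_trans[OF tensor_isomorphic_left] tensor_Unit_isomorphic Unit_Ob by blast
  then have "\<exists>C \<in> Ob K. isomorphic K (Unit K) (Unit K \<otimes>\<^sub>o C \<otimes>\<^sub>o Unit K)"
    using isomorphic_sym Unit_Ob by blast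
  \<comment> \<open>If the unit were a zero object, so would be \<open>A\<close>, which is
    isomorphic to its product with the unit.\<close>
  moreover have "Unit K \<notin> {Z. zero_object K Z}"
    using assms thick_ideal_tensor(1)[OF thick_ideal_zero] Unit_tensor_isomorphic
      zero_object_isomorphic by blast
  ultimately obtain Q where "prime_ideal K Q"
    using prime_ideal_avoiding_sequence[OF thick_ideal_zero, of "\<lambda>_. Unit K"] Unit_Ob by metis
  then show ?thesis unfolding Spc_def by blast
qed

end

theorem theorem1p2p1:
  fixes K :: "('o, 'm, 'z) monoidal_triangulated_cat_scheme" (structure)
  assumes "monoidal_triangulated_category K"
  shows "(\<forall>P. proper_thick_ideal K P \<longrightarrow>
      (prime_ideal K P \<longleftrightarrow>
        (\<forall>A \<in> Ob K. \<forall>B \<in> Ob K.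
          (\<forall>C \<in> Ob K. A \<otimes>\<^sub>o C \<otimes>\<^sub>o B \<in> P) \<longrightarrow> A \<in> P \<or> B \<in> P))) \<and>
    (\<forall>P. proper_thick_ideal K P \<longrightarrow>
      (semiprime_ideal K P \<longleftrightarrow>
        (\<forall>A \<in> Ob K. (\<forall>C \<in> Ob K. A \<otimes>\<^sub>o C \<otimes>\<^sub>o A \<in> P) \<longrightarrow> A \<in> P))) \<and>
    ((\<exists>A \<in> Ob K. \<not> zero_object K A) \<longrightarrow> Spc K \<noteq> {})"
proof -
  interpret M: monoidal_triangulated_category K by (rule assms)
  show ?thesis
  proof (intro conjI allI impI)
    fix P assume "proper_thick_ideal K P"
    then show "prime_ideal K P \<longleftrightarrow>
        (\<forall>A \<in> Ob K. \<forall>B \<in> Ob K.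
          (\<forall>C \<in> Ob K. A \<otimes>\<^sub>o C \<otimes>\<^sub>o B \<in> P) \<longrightarrow> A \<in> P \<or> B \<in> P)"
      by (rule M.prime_ideal_iff)
  next
    fix P assume "proper_thick_ideal K P"
    then show "semiprime_ideal K P \<longleftrightarrow>
        (\<forall>A \<in> Ob K. (\<forall>C \<in> Ob K. A \<otimes>\<^sub>o C \<otimes>\<^sub>o A \<in> P) \<longrightarrow> A \<in> P)"
      by (rule M.semiprime_ideal_iff)
  next
    assume "\<exists>A \<in> Ob K. \<not> zero_object K A"
    then show "Spc K \<noteq> {}" by (elim bexE) (rule M.Spc_nonempty)
  qed
qed

end
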